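(* Fix a vertex $v$ and fixed values of the noisy weights $w'_{ux}$. Then $$GS(f'_v)=GS(g)\cdot\max_{u:\{v,u\}\in E}\big|\{T\in\Delta_v:\{v,u\}\subseteq T\}\big|,$$ where $GS(g)=1$ when the biased estimator is used and $GS(g)=1+\frac{2p}{(1-p)^2}$ when the unbiased estimator is used.
   Context: Let $G=(V,E,w)$ be a finite simple undirected graph with integer weights $w_{uv}=w_{vu}$; for a vertex $v$ with neighborhood $\mathcal N(v)$ of size $d_v$, $w^v=(w_{vu})_{u\in\mathcal N(v)}\in\mathbb{Z}^{d_v}$. Let $\Delta$ be the set of triangles, $\rho:\Delta\to V$ an assignment with $\rho(T)\in T$, $\Delta_v=\rho^{-1}(v)$. Let $\lambda\in\mathbb{Z}$, $\varepsilon_1>0$, $p=e^{-\varepsilon_1}$. For each triangle $\{v,u,x\}\in\Delta_v$ a fixed integer $w'_{ux}$ (a noisy weight of edge $\{u,x\}$) is given. Define $f'_v:\mathbb{Z}^{d_v}\to\mathbb{R}$ by $f'_v(w^v)=\sum_{T=\{v,u,x\}\in\Delta_v}g_v^T(w^v)$, where either $g_v^T=\mathbf 1\{w_{vu}+w_{vx}+w'_{ux}<\lambda\}$ (biased estimator) or $g_v^T=h(w_{vu}+w_{vx}+w'_{ux})$ (unbiased estimator) with $h(m)=0$ for $m>\lambda$, $h(\lambda)=-\frac{p}{(1-p)^2}$, $h(\lambda-1)=1+\frac{p}{(1-p)^2}$, $h(m)=1$ for $m<\lambda-1$. The global sensitivity is $GS(f'_v)=\max\{|f'_v(a)-f'_v(b)|: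 a,b\in\mathbb{Z}^{d_v},\ \|a-b\|_1\le1\}$. *)

theory Defs
  imports Complex_Main "HOL-Library.FuncSet"
begin

locale weighted_graph =
  fixes V :: "'a set" and E :: "'a set set" and w :: "'a \<Rightarrow> 'a \<Rightarrow> int"
  assumes finite_V: "finite V"
    and edges: "e \<in> E \<Longrightarrow> e \<subseteq> V \<and> card e = 2"
    and weight_sym: "{u, x} \<in> E \<Longrightarrow> w u x = w x u"

definition neighborhood :: "'a set set \<Rightarrow> 'a \<Rightarrow> 'a set" where
  "neighborhood E v = {u. {v, u} \<in> E}"

definition triangles :: "'a set \<Rightarrow> 'a set set \<Rightarrow> 'a set set" where
  "triangles V E = {T. T \<subseteq> V \<and> card T = 3 \<and> (\<forall>x\<in>T. \<forall>y\<in>T. x \<noteq> y \<longrightarrow> {x, y} \<in> E)}"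

definition assigned_triangles ::
    "'a set \<Rightarrow> 'a set set \<Rightarrow> ('a set \<Rightarrow> 'a) \<Rightarrow> 'a \<Rightarrow> 'a set set" where
  "assigned_triangles V E \<rho> v = {T \<in> triangles V E. \<rho> T = v}"

definition unbiased_h :: "int \<Rightarrow> real \<Rightarrow> int \<Rightarrow> real" where
  "unbiased_h thr p m =
     (if m > thr then 0
      else if m = thr then - (p / (1 - p)\<^sup>2)
      else if m = thr - 1 then 1 + p / (1 - p)\<^sup>2
      else 1)"

datatype estimator = Biased | Unbiased

text \<open>For a triangle \<open>T = {v, u, x}\<close> the set \<open>T - {v}\<close> is the edge \<open>{u, x}\<close>, so \<open>noisy_sum w' v T a\<close>
  is \<open>a u + a x + w' {u, x}\<close>. The noisy weights are indexed by unordered edges.\<close>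

definition noisy_sum :: "('a set \<Rightarrow> int) \<Rightarrow> 'a \<Rightarrow> 'a set \<Rightarrow> ('a \<Rightarrow> int) \<Rightarrow> int" where
  "noisy_sum w' v T a = (\<Sum>u\<in>T - {v}. a u) + w' (T - {v})"

definition triangle_est ::
    "estimator \<Rightarrow> int \<Rightarrow> real \<Rightarrow> ('a set \<Rightarrow> int) \<Rightarrow> 'a \<Rightarrow> 'a set \<Rightarrow> ('a \<Rightarrow> int) \<Rightarrow> real" where
  "triangle_est est thr p w' v T a =
     (case est of
        Biased \<Rightarrow> (if noisy_sum w' v T a < thr then 1 else 0)
      | Unbiased \<Rightarrow> unbiased_h thr p (noisy_sum w' v T a))"

definition local_est ::
    "estimator \<Rightarrow> int \<Rightarrow> real \<Rightarrow> ('a set \<Rightarrow> int) \<Rightarrow> 'a set set \<Rightarrow> 'a \<Rightarrow> ('a \<Rightarrow> int) \<Rightarrow> real" where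
  "local_est est thr p w' \<Delta>v v a = (\<Sum>T\<in>\<Delta>v. triangle_est est thr p w' v T a)"

text \<open>Integer vectors indexed by a finite set \<open>I\<close> are the extensional functions on \<open>I\<close>. The maximum is
  taken with \<open>Greatest\<close> rather than \<open>Max\<close>, which is meaningful only for finite sets.\<close>

definition global_sensitivity :: "'i set \<Rightarrow> (('i \<Rightarrow> int) \<Rightarrow> real) \<Rightarrow> real" where
  "global_sensitivity I f =
     (GREATEST s. \<exists>a \<in> I \<rightarrow>\<^sub>E UNIV. \<exists>b \<in> I \<rightarrow>\<^sub>E UNIV.
        (\<Sum>i\<in>I. \<bar>a i - b i\<bar>) \<le> 1 \<and> s = \<bar>f a - f b\<bar>)"

text \<open>Inserting 0 only matters for an isolated vertex, where the maximum over the empty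
  neighborhood is read as 0.\<close>

definition max_edge_load :: "'a set set \<Rightarrow> 'a set set \<Rightarrow> 'a \<Rightarrow> nat" where
  "max_edge_load E \<Delta>v v =
     Max (insert 0 ((\<lambda>u. card {T \<in> \<Delta>v. {v, u} \<subseteq> T}) ` neighborhood E v))"

end

theory Submission
  imports Defs
begin

text \<open>Vectors at \<open>L\<^sub>1\<close>-distance at most 1 differ in at most one coordinate \<open>u\<close>, and there by one, so
  only the triangles through \<open>{v, u}\<close> contribute, each by at most the largest jump of the threshold
  function. Conversely, two triangles through \<open>{v, u}\<close> have different third vertices \<open>x\<close>, so the
  coordinates at these \<open>x\<close> can be chosen independently to place all the noisy sums at \<open>thr - 1\<close>;
  raising coordinate \<open>u\<close> by one then makes all of these triangles perform the largest jump
  simultaneously, in the same direction.\<close>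

text \<open>A triangle's estimate depends on the weight vector only through its noisy sum; isolating
  this function of one integer lets a single argument serve both estimators.\<close>

definition threshold_fun :: "estimator \<Rightarrow> int \<Rightarrow> real \<Rightarrow> int \<Rightarrow> real" where
  "threshold_fun est thr p m =
     (case est of Biased \<Rightarrow> (if m < thr then 1 else 0) | Unbiased \<Rightarrow> unbiased_h thr p m)"

definition threshold_jump :: "estimator \<Rightarrow> real \<Rightarrow> real" where
  "threshold_jump est p = (case est of Biased \<Rightarrow> 1 | Unbiased \<Rightarrow> 1 + 2 * p / (1 - p)\<^sup>2)"

lemma triangle_est_threshold_fun:
  "triangle_est est thr p w' v T a = threshold_fun est thr p (noisy_sum w' v T a)"
  by (simp add: triangle_est_def threshold_fun_def)

lemma threshold_jump_nonneg: "0 \<le> p \<Longrightarrow> 0 \<le> threshold_jump est p"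
  by (cases est) (auto simp: threshold_jump_def)

text \<open>Kept signed, without absolute value: the jumps of several triangles then add up instead
  of cancelling.\<close>

lemma threshold_fun_at_jump:
  "threshold_fun est thr p (thr - 1) - threshold_fun est thr p thr = threshold_jump est p"
  by (cases est) (auto simp: threshold_fun_def threshold_jump_def unbiased_h_def)

text \<open>With \<open>q = p / (1 - p)\<^sup>2\<close>, the unbiased function takes the values 1, 1
  + q, -q, 0 around \<open>thr\<close>. Its consecutive changes have sizes q, 1 + 2q, q, and the
  middle one dominates because q is nonnegative.\<close>

lemma threshold_fun_diff_le:
  assumes "0 \<le> p" "\<bar>m - n\<bar> \<le> 1"
  shows "\<bar>threshold_fun est thr p m - threshold_fun est thr p n\<bar> \<le> threshold_jump est p"
proof (cases est)
  case Biased
  then show ?thesis by (auto simp: threshold_fun_def threshold_jump_def)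
next
  case Unbiased
  \<comment> \<open>Treating the quotient as an atom leaves only linear inequalities in each
    case.\<close>
  define q where "q = p / (1 - p)\<^sup>2"
  have q: "0 \<le> q" "2 * p / (1 - p)\<^sup>2 = 2 * q" using assms(1) by (auto simp: q_def)
  show ?thesis using assms(2) q(1)
    unfolding threshold_fun_def threshold_jump_def unbiased_h_def Unbiased
      estimator.case q(2) q_def[symmetric]
    by (auto simp: abs_if)
qed

text \<open>\<open>GREATEST\<close> denotes the intended maximum once the value is known to be
  attained and to be an upper bound, so both are asked for.\<close>

lemma global_sensitivity_eqI:
  assumes "a \<in> I \<rightarrow>\<^sub>E UNIV" "b \<in> I \<rightarrow>\<^sub>E UNIV" "(\<Sum>i\<in>I. \<bar>a i - b i\<bar>) \<le> 1" "\<bar>f a - f b\<bar> = s"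
    and "\<And>a b. a \<in> I \<rightarrow>\<^sub>E UNIV \<Longrightarrow> b \<in> I \<rightarrow>\<^sub>E UNIV \<Longrightarrow> (\<Sum>i\<in>I. \<bar>a i - b i\<bar>) \<le> 1
           \<Longrightarrow> \<bar>f a - f b\<bar> \<le> s"
  shows "global_sensitivity I f = s"
  unfolding global_sensitivity_def using assms by (intro Greatest_equality) blast+

text \<open>Over the integers, one differing coordinate already contributes at least 1 and so
  exhausts the permitted distance.\<close>

lemma L1_dist_le_1_cases:
  fixes a b :: "'i \<Rightarrow> int"
  assumes "finite I" "a \<in> I \<rightarrow>\<^sub>E UNIV" "b \<in> I \<rightarrow>\<^sub>E UNIV" "(\<Sum>i\<in>I. \<bar>a i - b i\<bar>) \<le> 1"
  obtains "a = b"
    | u where "u \<in> I" "\<bar>a u - b u\<bar> = 1" "\<And>i. i \<noteq> u \<Longrightarrow> a i = b i"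
proof (cases "a = b")
  case False
  then obtain u where u: "u \<in> I" "a u \<noteq> b u"
    using PiE_ext[OF assms(2,3)] by blast
  have split: "(\<Sum>i\<in>I. \<bar>a i - b i\<bar>) = \<bar>a u - b u\<bar> + (\<Sum>i\<in>I - {u}. \<bar>a i - b i\<bar>)"
    using assms(1) u(1) by (rule sum.remove)
  have nonneg: "0 \<le> (\<Sum>i\<in>I - {u}. \<bar>a i - b i\<bar>)" by (simp add: sum_nonneg)
  have one: "\<bar>a u - b u\<bar> = 1" and "(\<Sum>i\<in>I - {u}. \<bar>a i - b i\<bar>) = 0"
    using split nonneg assms(4) u(2) by linarith+
  then have "\<forall>i\<in>I - {u}. \<bar>a i - b i\<bar> = 0"
    using assms(1) by (subst (asm) sum_nonneg_eq_0_iff) auto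
  \<comment> \<open>Outside \<open>I\<close> both vectors are \<open>undefined\<close> by
    extensionality, so agreement extends to every index.\<close>
  then have "a i = b i" if "i \<noteq> u" for i
    using that assms(2,3) by (cases "i \<in> I") (auto simp: PiE_def extensional_def)
  with u(1) one show thesis using that(2) by blast
qed (rule that(1))

text \<open>The triangle set is kept abstract so that the results apply both to all triangles
  assigned to \<open>v\<close> and to a single triangle; the latter yields GS(g).\<close>

locale vertex_triangles =
  fixes E :: "'a set set" and v :: 'a and \<Delta>v :: "'a set set"
  assumes finite_nbhd: "finite (neighborhood E v)"
    and not_self_nbr: "v \<notin> neighborhood E v"
    and finite_triangles: "finite \<Delta>v"
    and triangleD: "T \<in> \<Delta>v \<Longrightarrow> v \<in> T \<and> card T = 3 \<and> T \<subseteq> insert v (neighborhood E v)"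
begin

lemma load_le_max_edge_load:
  assumes "u \<in> neighborhood E v"
  shows "card {T \<in> \<Delta>v. u \<in> T} \<le> max_edge_load E \<Delta>v v"
proof -
  have "{T \<in> \<Delta>v. u \<in> T} = {T \<in> \<Delta>v. {v, u} \<subseteq> T}" using triangleD by auto
  then show ?thesis unfolding max_edge_load_def using finite_nbhd assms by (intro Max_ge) auto
qed

text \<open>A maximum of a finite set is one of its elements. The inserted 0 needs its own case
  because it provides no neighbor at which to build a jump.\<close>

lemma max_edge_load_cases:
  obtains "max_edge_load E \<Delta>v v = 0"
    | u where "u \<in> neighborhood E v" "max_edge_load E \<Delta>v v = card {T \<in> \<Delta>v. u \<in> T}"
proof -
  have eq: "{T \<in> \<Delta>v. u \<in> T} = {T \<in> \<Delta>v. {v, u} \<subseteq> T}" for u using triangleD by auto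
  have "max_edge_load E \<Delta>v v
      \<in> insert 0 ((\<lambda>u. card {T \<in> \<Delta>v. {v, u} \<subseteq> T}) ` neighborhood E v)"
    unfolding max_edge_load_def using finite_nbhd by (intro Max_in) auto
  then show thesis using that unfolding eq by blast
qed

lemma third_vertex:
  assumes "T \<in> \<Delta>v" "u \<in> T" "u \<noteq> v"
  obtains x where "x \<in> neighborhood E v" "x \<noteq> u" "T - {v} = {u, x}"
proof -
  have fin: "finite T" and T: "v \<in> T" "card T = 3" "T \<subseteq> insert v (neighborhood E v)"
    using triangleD[OF assms(1)] card.infinite[of T] by auto
  then have "card (T - {v} - {u}) = 1" using assms by simp
  then obtain x where "T - {v} - {u} = {x}" by (auto simp: card_1_singleton_iff)
  then show thesis using that[of x] assms T by blast
qed

lemma local_est_diff_le: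
  assumes "0 \<le> p" "a \<in> neighborhood E v \<rightarrow>\<^sub>E UNIV" "b \<in> neighborhood E v \<rightarrow>\<^sub>E UNIV"
    and "(\<Sum>i\<in>neighborhood E v. \<bar>a i - b i\<bar>) \<le> 1"
  shows "\<bar>local_est est thr p w' \<Delta>v v a - local_est est thr p w' \<Delta>v v b\<bar>
      \<le> threshold_jump est p * real (max_edge_load E \<Delta>v v)"
  using finite_nbhd assms(2-4)
proof (cases rule: L1_dist_le_1_cases)
  case 1
  then show ?thesis using threshold_jump_nonneg[OF assms(1)] by simp
next
  case (2 u)
  let ?J = "threshold_jump est p" and ?g = "triangle_est est thr p w' v"
  have diff: "\<bar>?g T a - ?g T b\<bar> \<le> (if u \<in> T then ?J else 0)" if "T \<in> \<Delta>v" for T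
  proof -
    have "finite T" using triangleD[OF that] card.infinite[of T] by auto
    have "noisy_sum w' v T a - noisy_sum w' v T b = (\<Sum>i\<in>T - {v}. a i - b i)"
      by (simp add: noisy_sum_def sum_subtractf)
    also have "\<dots> = (\<Sum>i\<in>T - {v}. if i = u then a u - b u else 0)"
      using 2(3) by (intro sum.cong) auto
    \<comment> \<open>As a neighbor of \<open>v\<close>, \<open>u\<close> differs from
      \<open>v\<close>, so removing \<open>v\<close> from \<open>T\<close> does not affect whether
      \<open>u\<close> is in it.\<close>
    also have "\<dots> = (if u \<in> T then a u - b u else 0)"
      using \<open>finite T\<close> 2(1) not_self_nbr by (auto simp: sum.delta)
    finally have eq: "noisy_sum w' v T a - noisy_sum w' v T b = (if u \<in> T then a u - b u else 0)" .
    show ?thesis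
    proof (cases "u \<in> T")
      case True
      then show ?thesis using eq 2(2)
        by (simp add: triangle_est_threshold_fun threshold_fun_diff_le assms(1))
    next
      case False
      then show ?thesis using eq by (simp add: triangle_est_threshold_fun)
    qed
  qed
  have "\<bar>local_est est thr p w' \<Delta>v v a - local_est est thr p w' \<Delta>v v b\<bar>
      \<le> (\<Sum>T\<in>\<Delta>v. \<bar>?g T a - ?g T b\<bar>)"
    unfolding local_est_def sum_subtractf[symmetric] by (rule sum_abs)
  also have "\<dots> \<le> (\<Sum>T\<in>\<Delta>v. if u \<in> T then ?J else 0)" using diff by (rule sum_mono)
  also have "\<dots> = ?J * real (card {T \<in> \<Delta>v. u \<in> T})"
    using finite_triangles by (simp add: sum.If_cases Int_def)
  also have "\<dots> \<le> ?J * real (max_edge_load E \<Delta>v v)"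
    using load_le_max_edge_load[OF 2(1)] threshold_jump_nonneg[OF assms(1)]
    by (intro mult_left_mono) auto
  finally show ?thesis .
qed

lemma local_est_jump:
  fixes w' :: "'a set \<Rightarrow> int"
  assumes "u \<in> neighborhood E v"
  obtains a b where "a \<in> neighborhood E v \<rightarrow>\<^sub>E UNIV" "b \<in> neighborhood E v \<rightarrow>\<^sub>E UNIV"
    "(\<Sum>i\<in>neighborhood E v. \<bar>a i - b i\<bar>) = 1"
    "local_est est thr p w' \<Delta>v v a - local_est est thr p w' \<Delta>v v b
       = threshold_jump est p * real (card {T \<in> \<Delta>v. u \<in> T})"
proof
  let ?N = "neighborhood E v" and ?g = "triangle_est est thr p w' v"
  \<comment> \<open>Since \<open>a u = 0\<close>, the triangle with third vertex \<open>x\<close>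
    has noisy sum \<open>a x + w' {u, x} = thr - 1\<close>; setting coordinate \<open>u\<close> to 1
    moves it to \<open>thr\<close>.\<close>
  define a where "a = (\<lambda>x\<in>?N. if x = u then 0 else thr - 1 - w' {u, x})"
  define b where "b = a(u := 1)"
  have uv: "u \<noteq> v" using assms not_self_nbr by blast
  show "a \<in> ?N \<rightarrow>\<^sub>E UNIV" by (simp add: a_def)
  then show "b \<in> ?N \<rightarrow>\<^sub>E UNIV" using assms by (auto simp: b_def PiE_def extensional_def)
  have "(\<Sum>i\<in>?N. \<bar>a i - b i\<bar>) = (\<Sum>i\<in>?N. if i = u then 1 else 0)"
    using assms by (intro sum.cong) (auto simp: a_def b_def)
  then show "(\<Sum>i\<in>?N. \<bar>a i - b i\<bar>) = 1" using assms finite_nbhd by simp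
  have diff: "?g T a - ?g T b = (if u \<in> T then threshold_jump est p else 0)" if "T \<in> \<Delta>v" for T
  proof (cases "u \<in> T")
    case True
    obtain x where x: "x \<in> ?N" "x \<noteq> u" "T - {v} = {u, x}"
      using third_vertex[OF \<open>T \<in> \<Delta>v\<close> True uv] .
    then have "noisy_sum w' v T a = thr - 1" "noisy_sum w' v T b = thr"
      using assms by (auto simp: noisy_sum_def a_def b_def)
    then show ?thesis using True by (simp add: triangle_est_threshold_fun threshold_fun_at_jump)
  next
    case False
    then have "noisy_sum w' v T a = noisy_sum w' v T b"
      by (auto simp: noisy_sum_def b_def intro!: sum.cong split: if_splits)
    then show ?thesis using False by (simp add: triangle_est_threshold_fun)
  qed
  have "local_est est thr p w' \<Delta>v v a - local_est est thr p w' \<Delta>v v b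
      = (\<Sum>T\<in>\<Delta>v. if u \<in> T then threshold_jump est p else 0)"
    unfolding local_est_def sum_subtractf[symmetric] using diff by (intro sum.cong) auto
  then show "local_est est thr p w' \<Delta>v v a - local_est est thr p w' \<Delta>v v b
       = threshold_jump est p * real (card {T \<in> \<Delta>v. u \<in> T})"
    using finite_triangles by (simp add: sum.If_cases Int_def)
qed

theorem global_sensitivity_local_est:
  assumes "0 \<le> p"
  shows "global_sensitivity (neighborhood E v) (local_est est thr p w' \<Delta>v v)
      = threshold_jump est p * real (max_edge_load E \<Delta>v v)"
proof (cases rule: max_edge_load_cases)
  case 1
  \<comment> \<open>With load 0 the upper bound is 0, and any vector paired with itself attains
    it.\<close>
  define z :: "'a \<Rightarrow> int" where "z = (\<lambda>x\<in>neighborhood E v. 0)"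
  have z: "z \<in> neighborhood E v \<rightarrow>\<^sub>E UNIV" by (simp add: z_def)
  show ?thesis
    by (rule global_sensitivity_eqI[OF z z _ _ local_est_diff_le[OF assms]]) (simp_all add: 1)
next
  case (2 u)
  obtain a b where ab: "a \<in> neighborhood E v \<rightarrow>\<^sub>E UNIV" "b \<in> neighborhood E v \<rightarrow>\<^sub>E UNIV"
    "(\<Sum>i\<in>neighborhood E v. \<bar>a i - b i\<bar>) = 1"
    "local_est est thr p w' \<Delta>v v a - local_est est thr p w' \<Delta>v v b
       = threshold_jump est p * real (card {T \<in> \<Delta>v. u \<in> T})"
    using local_est_jump[OF 2(1)] .
  show ?thesis
    by (rule global_sensitivity_eqI[OF ab(1,2) _ _ local_est_diff_le[OF assms]])
      (simp_all add: ab(3,4) 2(2) threshold_jump_nonneg[OF assms])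
qed

end

lemma (in weighted_graph) vertex_triangles_subset:
  assumes "\<Delta>v \<subseteq> triangles V E" "\<And>T. T \<in> \<Delta>v \<Longrightarrow> v \<in> T"
  shows "vertex_triangles E v \<Delta>v"
proof
  have "neighborhood E v \<subseteq> V" using edges by (fastforce simp: neighborhood_def)
  then show "finite (neighborhood E v)" using finite_V finite_subset by blast
  \<comment> \<open>A loop would be the set \<open>{v, v}\<close>, which has one element, whereas
    edges have two.\<close>
  show "v \<notin> neighborhood E v" using edges[of "{v, v}"] by (auto simp: neighborhood_def)
  have "triangles V E \<subseteq> Pow V" by (auto simp: triangles_def)
  then show "finite \<Delta>v" using assms(1) finite_V by (meson finite_Pow_iff finite_subset)
  show "v \<in> T \<and> card T = 3 \<and> T \<subseteq> insert v (neighborhood E v)" if "T \<in> \<Delta>v" for T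
    using assms(1) assms(2)[OF that] that by (auto simp: triangles_def neighborhood_def)
qed

text \<open>A lone triangle loads each of its two edges at \<open>v\<close> once and every other
  edge not at all. This turns the general formula into the value of GS(g).\<close>

lemma max_edge_load_singleton:
  assumes "vertex_triangles E v {T}"
  shows "max_edge_load E {T} v = 1"
proof -
  interpret vertex_triangles E v "{T}" by fact
  have T: "v \<in> T" "card T = 3" "T \<subseteq> insert v (neighborhood E v)" using triangleD by auto
  have "T \<noteq> {v}" using T(2) by auto
  then obtain u where u: "u \<in> T" "u \<noteq> v" using T(1) by blast
  then have "{T' \<in> {T}. u \<in> T'} = {T}" by auto
  then have "1 \<le> max_edge_load E {T} v"
    using load_le_max_edge_load[of u] T(3) u by auto
  moreover have "max_edge_load E {T} v \<le> 1"
  proof (cases rule: max_edge_load_cases)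
    case (2 u)
    then show ?thesis using card_mono[of "{T}" "{T' \<in> {T}. u \<in> T'}"] by auto
  qed simp
  ultimately show ?thesis by linarith
qed

theorem mainTheorem5:
  fixes V :: "'a set" and E :: "'a set set" and w :: "'a \<Rightarrow> 'a \<Rightarrow> int"
    and \<rho> :: "'a set \<Rightarrow> 'a" and w' :: "'a set \<Rightarrow> int" and v :: 'a
    and thr :: int and \<epsilon>\<^sub>1 p GSg :: real and est :: estimator
  assumes "weighted_graph V E w"
    and "\<And>T. T \<in> triangles V E \<Longrightarrow> \<rho> T \<in> T"
    and "v \<in> V"
    and "\<epsilon>\<^sub>1 > 0"
    and "p = exp (- \<epsilon>\<^sub>1)"
    and "GSg = (case est of Biased \<Rightarrow> 1 | Unbiased \<Rightarrow> 1 + 2 * p / (1 - p)\<^sup>2)"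
  shows "(\<forall>T \<in> assigned_triangles V E \<rho> v.
            global_sensitivity (neighborhood E v) (triangle_est est thr p w' v T) = GSg)
       \<and> global_sensitivity (neighborhood E v)
            (local_est est thr p w' (assigned_triangles V E \<rho> v) v)
          = GSg * real (max_edge_load E (assigned_triangles V E \<rho> v) v)"
proof -
  interpret weighted_graph V E w by fact
  let ?\<Delta> = "assigned_triangles V E \<rho> v"
  have p: "0 \<le> p" using assms(5) by simp
  have GSg: "GSg = threshold_jump est p" using assms(6) by (simp add: threshold_jump_def)
  have sub: "?\<Delta> \<subseteq> triangles V E" by (auto simp: assigned_triangles_def)
  have mem: "v \<in> T" if "T \<in> ?\<Delta>" for T using that assms(2) by (auto simp: assigned_triangles_def)
  have "global_sensitivity (neighborhood E v) (triangle_est est thr p w' v T) = GSg"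
    if T: "T \<in> ?\<Delta>" for T
  proof -
    have vt: "vertex_triangles E v {T}" using sub mem T by (intro vertex_triangles_subset) auto
    \<comment> \<open>Read as a sum over one triangle, the single estimate falls under the general
      theorem with load 1.\<close>
    have "triangle_est est thr p w' v T = local_est est thr p w' {T} v"
      by (auto simp: local_est_def)
    then show ?thesis
      using vertex_triangles.global_sensitivity_local_est[OF vt p] max_edge_load_singleton[OF vt]
      by (simp add: GSg)
  qed
  moreover have "vertex_triangles E v ?\<Delta>" using sub mem by (rule vertex_triangles_subset)
  ultimately show ?thesis
    by (simp add: vertex_triangles.global_sensitivity_local_est p GSg)
qed

end
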